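(* Let $x$ be a positive integer and for $k\geq 1$ let $$F_k(x):=\left[x,\frac{1}{x},x^2,\frac{1}{x^2},x^3,\frac{1}{x^3},x^4,\frac{1}{x^4},\dots,x^k,\frac{1}{x^k}\right].$$ Then, as $k\to\infty$, $F_k(x)$ converges to a quadratic irrational that is the positive root (in $z$) of the polynomial $P(x,z)=z^2-(2x-1)z-x$.
   Context: For positive real numbers $b_0,b_1,\dots,b_n$, the notation $[b_0,b_1,\dots,b_n]$ denotes the finite continued fraction $b_0+\cfrac{1}{b_1+\cfrac{1}{b_2+\cdots+\cfrac{1}{b_n}}}$; the partial quotients need not be integers. Thus $F_k(x)$ has $2k$ partial quotients, alternating $x^i, 1/x^i$ for $i=1,\dots,k$. A quadratic irrational is an irrational real number that is a root of a quadratic polynomial with integer coefficients. *)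

theory Defs
  imports Complex_Main "HOL-Computational_Algebra.Polynomial"
begin

text \<open>Finite continued fractions with arbitrary real partial quotients. The value at the empty
  list is a dummy; it is only reached by \<open>F 0 x\<close> below.\<close>

fun cont_frac :: "real list \<Rightarrow> real" where
  "cont_frac [] = 0"
| "cont_frac [b] = b"
| "cont_frac (b # c # bs) = b + 1 / cont_frac (c # bs)"

definition F :: "nat \<Rightarrow> real \<Rightarrow> real" where
  "F k x = cont_frac (concat (map (\<lambda>i. [x ^ i, 1 / x ^ i]) [1..<Suc k]))"

definition P :: "real \<Rightarrow> real \<Rightarrow> real" where
  "P x z = z\<^sup>2 - (2 * x - 1) * z - x"

definition quadratic_irrational :: "real \<Rightarrow> bool" where
  "quadratic_irrational z \<longleftrightarrow>
     z \<notin> \<rat> \<and> (\<exists>p :: int poly. degree p = 2 \<and> poly (map_poly of_int p) z = 0)"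

end

theory Submission
  imports Defs
begin

text \<open>Multiplying the partial quotients alternately by \<open>c\<close> and \<open>1 / c\<close> multiplies the value
  by \<open>c\<close>. Hence the tail starting at \<open>x ^ (m + 1)\<close> is \<open>x ^ m\<close> times a fraction of
  the original shape, and the values satisfy \<open>F (k + 1) x = x + x * F k x / (F k x + 1)\<close>. This
  iteration contracts \<open>{x..}\<close> by a factor \<open>1 / 4\<close>, and its positive fixed point is the positive
  root of \<open>P x\<close>. The root is irrational because the discriminant \<open>4 x\<^sup>2 + 1\<close> lies strictly
  between the consecutive squares of \<open>2 x\<close> and \<open>2 x + 1\<close>.\<close>

definition cf_step :: "real \<Rightarrow> real \<Rightarrow> real" where
  "cf_step x t = x + x * t / (t + 1)"

lemma cont_frac_Cons_Cons:
  "bs \<noteq> [] \<Longrightarrow> cont_frac (b # c # bs) = b + 1 / (c + 1 / cont_frac bs)"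
  by (cases bs) auto

lemma cf_step_ge:
  assumes "x \<ge> 0" "t \<ge> 0"
  shows "cf_step x t \<ge> x"
  using assms by (simp add: cf_step_def)

lemma funpow_cf_step_ge:
  assumes "x \<ge> 0"
  shows "(cf_step x ^^ n) (2 * x) \<ge> x"
proof (induction n)
  case (Suc n)
  then show ?case using cf_step_ge[of x] assms by simp
qed (use assms in simp)

text \<open>The start index \<open>Suc m\<close> is kept general because peeling off the first pair
  of quotients leaves a tail from \<open>Suc (Suc m)\<close> with one pair fewer; the factor
  \<open>x ^ Suc m\<close> of that tail then cancels into a single \<open>cf_step\<close>. The seed
  \<open>2 * x\<close> is the one-pair value x + 1 / (1 / x).\<close>

lemma cont_frac_tail:
  fixes x :: real
  assumes "x > 0"
  shows "cont_frac (concat (map (\<lambda>i. [x ^ i, 1 / x ^ i]) [Suc m..<Suc m + Suc n]))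
           = x ^ m * (cf_step x ^^ n) (2 * x)"
proof (induction n arbitrary: m)
  case 0
  then show ?case by simp
next
  case (Suc n)
  define t where "t = (cf_step x ^^ n) (2 * x)"
  have t: "t > 0"
    using funpow_cf_step_ge[of x n] assms by (simp add: t_def)
  let ?tail = "concat (map (\<lambda>i. [x ^ i, 1 / x ^ i]) [Suc (Suc m)..<Suc (Suc m) + Suc n])"
  have "[Suc m..<Suc m + Suc (Suc n)] = Suc m # [Suc (Suc m)..<Suc (Suc m) + Suc n]"
    by (subst upt_conv_Cons) simp_all
  then have "cont_frac (concat (map (\<lambda>i. [x ^ i, 1 / x ^ i]) [Suc m..<Suc m + Suc (Suc n)]))
      = cont_frac (x ^ Suc m # 1 / x ^ Suc m # ?tail)"
    by (simp only: list.map concat.simps append.simps)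
  also have "\<dots> = x ^ Suc m + 1 / (1 / x ^ Suc m + 1 / cont_frac ?tail)"
    by (rule cont_frac_Cons_Cons) (simp add: upt_conv_Cons del: upt_Suc)
  also have "\<dots> = x ^ Suc m + 1 / (1 / x ^ Suc m + 1 / (x ^ Suc m * t))"
    by (simp only: Suc.IH t_def)
  also have "1 / x ^ Suc m + 1 / (x ^ Suc m * t) = (t + 1) / (x ^ Suc m * t)"
    using assms t by (simp add: field_simps)
  also have "x ^ Suc m + 1 / \<dots> = x ^ m * cf_step x t"
    by (simp add: cf_step_def algebra_simps)
  finally show ?case by (simp add: t_def)
qed

lemma F_Suc_eq: "x > 0 \<Longrightarrow> F (Suc n) x = (cf_step x ^^ n) (2 * x)"
  using cont_frac_tail[of x 0 n] by (simp add: F_def)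

text \<open>The difference quotient is x / ((s + 1) (t + 1)). For s and t at least x it is bounded
  by x / (x + 1)^2, hence by 1 / 4, since (x - 1)^2 is nonnegative.\<close>

lemma cf_step_contraction:
  assumes "x > 0" "s \<ge> x" "t \<ge> x"
  shows "\<bar>cf_step x s - cf_step x t\<bar> \<le> \<bar>s - t\<bar> / 4"
proof -
  let ?r = "x / ((s + 1) * (t + 1))"
  have "cf_step x s - cf_step x t = ?r * (s - t)"
    using assms by (simp add: cf_step_def field_simps)
  moreover have "?r \<le> 1 / 4"
  proof -
    have "4 * x \<le> (x + 1) * (x + 1)"
      using zero_le_power2[of "x - 1"] by (simp add: power2_eq_square algebra_simps)
    also have "\<dots> \<le> (s + 1) * (t + 1)"
      using assms by (intro mult_mono) auto
    finally show ?thesis using assms by (simp add: field_simps)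
  qed
  moreover have "?r \<ge> 0" using assms by simp
  ultimately have "\<bar>cf_step x s - cf_step x t\<bar> = ?r * \<bar>s - t\<bar>"
    by (simp only: abs_mult abs_of_nonneg)
  also have "\<dots> \<le> 1 / 4 * \<bar>s - t\<bar>"
    by (rule mult_right_mono) (use \<open>?r \<le> 1 / 4\<close> in simp_all)
  finally show ?thesis by simp
qed

lemma F_tendsto_fixed_point:
  assumes "x > 0" "z > 0" "cf_step x z = z"
  shows "(\<lambda>k. F k x) \<longlonglongrightarrow> z"
proof -
  \<comment> \<open>Being a value of \<open>cf_step x\<close>, the fixed point lies in the region
    where the contraction estimate applies.\<close>
  have "z \<ge> x" using cf_step_ge[of x z] assms by simp
  have bound: "\<bar>(cf_step x ^^ n) (2 * x) - z\<bar> \<le> (1 / 4) ^ n * \<bar>2 * x - z\<bar>" for n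
  proof (induction n)
    case (Suc n)
    have "\<bar>(cf_step x ^^ Suc n) (2 * x) - z\<bar> \<le> \<bar>(cf_step x ^^ n) (2 * x) - z\<bar> / 4"
      using cf_step_contraction[of x "(cf_step x ^^ n) (2 * x)" z] funpow_cf_step_ge[of x n]
        assms \<open>z \<ge> x\<close> by simp
    with Suc show ?case by simp
  qed simp
  have "(\<lambda>n. (1 / 4) ^ n * \<bar>2 * x - z\<bar>) \<longlonglongrightarrow> 0"
    by (intro tendsto_mult_left_zero LIMSEQ_realpow_zero) auto
  then have "(\<lambda>n. (cf_step x ^^ n) (2 * x) - z) \<longlonglongrightarrow> 0"
    by (rule tendsto_0_le[where K = 1, OF _ always_eventually]) (simp_all add: abs_mult bound)
  then have "(\<lambda>n. F (Suc n) x) \<longlonglongrightarrow> z"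
    using assms(1) by (simp add: F_Suc_eq LIM_zero_cancel)
  \<comment> \<open>The iteration describes \<open>F\<close> from index 1 on; prepending one term
    keeps the limit.\<close>
  then show ?thesis by (rule LIMSEQ_imp_Suc)
qed

lemma P_eq_0_iff_fixed_point:
  assumes "z > 0"
  shows "P x z = 0 \<longleftrightarrow> cf_step x z = z"
  using assms by (auto simp: P_def cf_step_def field_simps power2_eq_square)

text \<open>By Vieta, two distinct roots have sum 2 x - 1 and product -x, so they cannot both be
  positive.\<close>

lemma P_pos_root_unique:
  assumes "x > 0" "z > 0" "w > 0" "P x z = 0" "P x w = 0"
  shows "w = z"
proof (rule ccontr)
  assume "w \<noteq> z"
  have "(w - z) * (w + z - (2 * x - 1)) = P x w - P x z"
    by (simp add: P_def power2_eq_square algebra_simps)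
  with assms \<open>w \<noteq> z\<close> have w: "w = 2 * x - 1 - z" by simp
  have "z * w = - x"
    using assms(4) unfolding w by (simp add: P_def power2_eq_square algebra_simps)
  with assms show False
    using mult_pos_pos[of z w] by simp
qed

lemma P_pos_root_exists:
  assumes "x > 0"
  obtains z where "z > 0" "P x z = 0"
proof
  \<comment> \<open>The discriminant (2 x - 1)^2 + 4 x simplifies to 4 x^2 + 1; the witness is the
    larger root.\<close>
  let ?s = "sqrt (4 * x\<^sup>2 + 1)"
  have "1 < ?s" using assms by simp
  with assms have "2 * x - 1 + ?s > 0" by linarith
  then show "(2 * x - 1 + ?s) / 2 > 0" by simp
  have "?s * ?s = 4 * x\<^sup>2 + 1" by simp
  then show "P x ((2 * x - 1 + ?s) / 2) = 0"
    by (simp add: P_def power2_eq_square field_simps)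
qed

lemma P_root_irrational:
  fixes x :: int
  assumes "x > 0" "P (of_int x) z = 0"
  shows "z \<notin> \<rat>"
proof
  assume "z \<in> \<rat>"
  then obtain a b :: int where ab: "b > 0" "coprime a b" "z = of_int a / of_int b"
    by (rule Rats_cases')
  \<comment> \<open>Rational root argument: the polynomial is monic in z, so the reduced denominator
    b must be 1.\<close>
  have "real_of_int (a\<^sup>2) = of_int (b * ((2 * x - 1) * a + x * b))"
    using assms(2) ab(1) by (simp add: ab(3) P_def power2_eq_square field_simps)
  then have eq: "a\<^sup>2 = b * ((2 * x - 1) * a + x * b)" by (simp only: of_int_eq_iff)
  then have "b dvd a\<^sup>2" by simp
  moreover have "coprime b (a\<^sup>2)" using ab(2) by (simp add: coprime_commute)
  ultimately have "is_unit b" by (metis coprime_absorb_left)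
  with ab(1) have "b = 1" by simp
  \<comment> \<open>Completing the square makes c^2 the discriminant; the absolute value gives the
    nonnegativity needed to compare c with 2 x through squares.\<close>
  define c where "c = \<bar>2 * a - (2 * x - 1)\<bar>"
  have c: "c\<^sup>2 = 4 * x\<^sup>2 + 1"
    using eq \<open>b = 1\<close> by (simp add: c_def power2_eq_square algebra_simps)
  have "(2 * x)\<^sup>2 < c\<^sup>2" using c by (simp add: power2_eq_square)
  then have "2 * x < c" by (rule power2_less_imp_less) (simp add: c_def)
  moreover have "c\<^sup>2 < (2 * x + 1)\<^sup>2"
    using c assms(1) by (simp add: power2_eq_square algebra_simps)
  then have "c < 2 * x + 1" by (rule power2_less_imp_less) (use assms(1) in simp)
  ultimately show False by simp
qed

theorem theorem12:
  fixes x :: int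
  assumes "x > 0"
  shows "\<exists>z :: real. (\<lambda>k. F k (real_of_int x)) \<longlonglongrightarrow> z
           \<and> quadratic_irrational z
           \<and> z > 0 \<and> P (real_of_int x) z = 0
           \<and> (\<forall>w > 0. P (real_of_int x) w = 0 \<longrightarrow> w = z)"
proof -
  have x: "real_of_int x > 0" using assms by simp
  then obtain z where z: "z > 0" "P (real_of_int x) z = 0"
    by (rule P_pos_root_exists)
  let ?p = "[:- x, - (2 * x - 1), 1:]"
  have "degree ?p = 2" by simp
  moreover have "poly (map_poly of_int ?p) z = 0"
    using z(2) by (simp add: map_poly_pCons P_def power2_eq_square algebra_simps)
  ultimately have "quadratic_irrational z"
    unfolding quadratic_irrational_def using P_root_irrational[OF assms z(2)] by blast
  moreover have "(\<lambda>k. F k (real_of_int x)) \<longlonglongrightarrow> z"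
    using F_tendsto_fixed_point x z P_eq_0_iff_fixed_point by blast
  ultimately show ?thesis
    using z P_pos_root_unique[OF x z(1) _ z(2)] by blast
qed

end
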